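(* Let $\Gamma$ be a general chain of $g$ loops. Let $T$ be a rectangular Young tableau with $r+1$ columns (numbered $0,\dots,r$) and $g-d+r$ rows, filled with distinct integers among $1,\dots,g$, strictly increasing along rows and columns. A general point of the component of the Brill-Noether locus of degree $d$ and rank $r$ on $\Gamma$ corresponding to $T$ is the class of a divisor of the form $$rQ_0+\sum_{i=1}^g\epsilon_i x_i,\qquad x_i\in\Gamma_i,$$ where $$\begin{cases}\epsilon_i=0 & \text{if } t(i)=r,\\ \epsilon_i=1,\quad x_i+(r+\beta_{i,t(i)}-t(i)-\beta_{i,r}-1)Q_{i-1}\equiv(r+\beta_{i,t(i)}-t(i)-\beta_{i,r})Q_i & \text{if } t(i)<r,\\ \epsilon_i=1,\quad x_i\text{ generic} & \text{if } i \text{ is not in } T.\end{cases}$$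
   Context: Divisors on a metric graph $\Gamma$ are finite integral combinations of points; two divisors are equivalent ($\equiv$) if they differ by the divisor of a continuous piecewise linear function with integral slopes (weight at a point: sum of incoming slopes). $D$ has rank at least $r$ if for every effective $D'$ of degree $r$, $D-D'$ is equivalent to an effective divisor. The Brill-Noether locus of degree $d$ and rank $r$ is the set of classes of degree $d$ divisors of rank at least $r$. Chain of $g$ loops: for $i=1,\dots,g$, identify the two ends of a segment of length $l_i$ with the two ends of a segment of length $m_i$ to obtain a loop $\Gamma_i$ with marked points $Q_{i-1},Q_i$; glue $\Gamma_i$ to $\Gamma_{i+1}$ at $Q_i$ ($i=1,\dots,g-1$). It is general if the lengths are generic, in the sense that no quotient $l_i/m_i$ equals the quotient of two positive integers less than $2g-2$. Notation for a tableau $T$: if $i$ appears in $T$, $t(i)$ is its column; $\beta_{i,t}$ is the number of entries $j\le i$ of $T$ lying in column $t$. Component corresponding to $T$: every divisor $D$ is equivalent to a divisor $uQ_0+\sum_i\epsilon_i x_i$ with $\epsilon_i\in\{0,1\}$, $x_i\in\Gamma_i-\{Q_{i-1}\}$. The general points of the component corresponding to $T$ are the classes of degree $d$ whose data $u,\epsilon_i,x_i$ satisfy the following, where integers $u_s(i)$, $0\le s\le r$, $0\le i\le g$, are defined recursively starting from $u_s(0)=u-s$, with $u_r(0)=0,\ u_s(g)=r-s$, and $u_0(i)>\dots>u_r(i)\ge0$ for all $i$: - if $i$ is in column $r$ of $T$: $\epsilon_i=0$, $u_r(i-1)=0$, and $u_s(i)=u_s(i-1)-1$ for $s<r$, $u_r(i)=u_r(i-1)$;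 - if $i$ is in column $t<r$ of $T$: $\epsilon_i=1$, $u_t(i-1)Q_{i-1}+x_i\equiv(u_t(i-1)+1)Q_i$, $u_t(i-1)+1<u_{t-1}(i-1)$ when $t>0$, and $u_t(i)=u_t(i-1)+1$, $u_s(i)=u_s(i-1)$ for $s\neq t$; - if $i$ is not in $T$: $\epsilon_i=1$, $x_i$ is generic, i.e. for no $s$ is $u_s(i-1)Q_{i-1}+x_i\equiv(u_s(i-1)+1)Q_i$, and $u_s(i)=u_s(i-1)$ for all $s$. *)

theory Defs
  imports Complex_Main "HOL-Library.Poly_Mapping"
begin

record ('v, 'e) metric_graph =
  verts :: "'v set"
  edges :: "'e set"
  src :: "'e \<Rightarrow> 'v"
  tgt :: "'e \<Rightarrow> 'v"
  len :: "'e \<Rightarrow> real"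

definition metric_graph :: "('v, 'e) metric_graph \<Rightarrow> bool" where
  "metric_graph G \<longleftrightarrow> finite (verts G) \<and> verts G \<noteq> {} \<and> finite (edges G) \<and>
     (\<forall>e\<in>edges G. src G e \<in> verts G \<and> tgt G e \<in> verts G \<and> len G e > 0)"

text \<open>A point is a vertex or an interior point of an edge, given by its distance from the source.\<close>

datatype ('v, 'e) mpoint = Vert 'v | Inner 'e real

definition points :: "('v, 'e) metric_graph \<Rightarrow> ('v, 'e) mpoint set" where
  "points G = Vert ` verts G \<union> {Inner e t | e t. e \<in> edges G \<and> 0 < t \<and> t < len G e}"

definition edge_point :: "('v, 'e) metric_graph \<Rightarrow> 'e \<Rightarrow> real \<Rightarrow> ('v, 'e) mpoint" where
  "edge_point G e t =
     (if t = 0 then Vert (src G e) else if t = len G e then Vert (tgt G e) else Inner e t)"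

definition edge_points :: "('v, 'e) metric_graph \<Rightarrow> 'e \<Rightarrow> ('v, 'e) mpoint set" where
  "edge_points G e = edge_point G e ` {0..len G e}"

definition integral_PL_on :: "real \<Rightarrow> (real \<Rightarrow> real) \<Rightarrow> bool" where
  "integral_PL_on L F \<longleftrightarrow> continuous_on {0..L} F \<and>
     (\<exists>B. finite B \<and> (\<forall>a b. 0 \<le> a \<and> a < b \<and> b \<le> L \<and> {a<..<b} \<inter> B = {} \<longrightarrow>
        (\<exists>(k::int) c. \<forall>t\<in>{a<..<b}. F t = of_int k * t + c)))"

definition PL_functions :: "('v, 'e) metric_graph \<Rightarrow> (('v, 'e) mpoint \<Rightarrow> real) set" where
  "PL_functions G = {f. \<forall>e\<in>edges G. integral_PL_on (len G e) (\<lambda>t. f (edge_point G e t))}"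

text \<open>Both one-sided slopes are taken in the direction of increasing parameter, so the slopes
  incoming at \<open>t\<close> are \<open>slope_left F t\<close> and \<open>- slope_right F t\<close>.\<close>

definition slope_left :: "(real \<Rightarrow> real) \<Rightarrow> real \<Rightarrow> int" where
  "slope_left F t = (THE k. \<forall>\<^sub>F s in at_left t. F s = F t + of_int k * (s - t))"

definition slope_right :: "(real \<Rightarrow> real) \<Rightarrow> real \<Rightarrow> int" where
  "slope_right F t = (THE k. \<forall>\<^sub>F s in at_right t. F s = F t + of_int k * (s - t))"

fun div_weight :: "('v, 'e) metric_graph \<Rightarrow> (('v, 'e) mpoint \<Rightarrow> real) \<Rightarrow> ('v, 'e) mpoint \<Rightarrow> int" where
  "div_weight G f (Vert v) =
     (\<Sum>e\<in>{e\<in>edges G. tgt G e = v}. slope_left (\<lambda>s. f (edge_point G e s)) (len G e))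
   - (\<Sum>e\<in>{e\<in>edges G. src G e = v}. slope_right (\<lambda>s. f (edge_point G e s)) 0)"
| "div_weight G f (Inner e t) =
     slope_left (\<lambda>s. f (edge_point G e s)) t - slope_right (\<lambda>s. f (edge_point G e s)) t"

type_synonym ('v, 'e) divisor = "('v, 'e) mpoint \<Rightarrow>\<^sub>0 int"

abbreviation mult_point :: "int \<Rightarrow> ('v, 'e) mpoint \<Rightarrow> ('v, 'e) divisor" (infix "\<odot>" 70) where
  "k \<odot> p \<equiv> Poly_Mapping.single p k"

definition divisors :: "('v, 'e) metric_graph \<Rightarrow> ('v, 'e) divisor set" where
  "divisors G = {D. Poly_Mapping.keys D \<subseteq> points G}"

definition deg :: "('v, 'e) divisor \<Rightarrow> int" where
  "deg D = (\<Sum>p\<in>Poly_Mapping.keys D. Poly_Mapping.lookup D p)"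

definition lin_equiv :: "('v, 'e) metric_graph \<Rightarrow> ('v, 'e) divisor \<Rightarrow> ('v, 'e) divisor \<Rightarrow> bool" where
  "lin_equiv G D D' \<longleftrightarrow> D \<in> divisors G \<and> D' \<in> divisors G \<and>
     (\<exists>f\<in>PL_functions G. \<forall>p\<in>points G. Poly_Mapping.lookup (D - D') p = div_weight G f p)"

definition div_class :: "('v, 'e) metric_graph \<Rightarrow> ('v, 'e) divisor \<Rightarrow> ('v, 'e) divisor set" where
  "div_class G D = {D'. lin_equiv G D D'}"

text \<open>The chain of \<open>g\<close> loops: the vertex \<open>i\<close> is \<open>Q\<^sub>i\<close>, and the loop \<open>\<Gamma>\<^sub>i\<close> consists of the two edges
  \<open>(i, True)\<close> of length \<open>l\<^sub>i\<close> and \<open>(i, False)\<close> of length \<open>m\<^sub>i\<close>, both from \<open>Q\<^sub>i\<^sub>-\<^sub>1\<close> to \<open>Q\<^sub>i\<close>.\<close>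

definition chain :: "nat \<Rightarrow> (nat \<Rightarrow> real) \<Rightarrow> (nat \<Rightarrow> real) \<Rightarrow> (nat, nat \<times> bool) metric_graph" where
  "chain g l m = \<lparr>verts = {0..g}, edges = {1..g} \<times> UNIV, src = (\<lambda>(i, _). i - 1), tgt = fst,
     len = (\<lambda>(i, b). if b then l i else m i)\<rparr>"

abbreviation Q :: "nat \<Rightarrow> (nat, nat \<times> bool) mpoint" where
  "Q i \<equiv> Vert i"

definition chain_loop :: "(nat, nat \<times> bool) metric_graph \<Rightarrow> nat \<Rightarrow> (nat, nat \<times> bool) mpoint set" where
  "chain_loop G i = edge_points G (i, True) \<union> edge_points G (i, False)"

definition general_chain :: "nat \<Rightarrow> (nat \<Rightarrow> real) \<Rightarrow> (nat \<Rightarrow> real) \<Rightarrow> bool" where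
  "general_chain g l m \<longleftrightarrow> (\<forall>i\<in>{1..g}. 0 < l i \<and> 0 < m i \<and>
     \<not> (\<exists>a b :: int. 0 < a \<and> a < 2 * int g - 2 \<and> 0 < b \<and> b < 2 * int g - 2 \<and>
          l i / m i = of_int a / of_int b))"

lemma metric_graph_chain: "general_chain g l m \<Longrightarrow> metric_graph (chain g l m)"
  by (auto simp: metric_graph_def chain_def general_chain_def)

text \<open>A tableau with \<open>n\<close> rows and columns \<open>0, \<dots>, r\<close>; \<open>T a t\<close> is the entry in row \<open>a < n\<close> and
  column \<open>t \<le> r\<close>.\<close>

definition rect_tableau :: "nat \<Rightarrow> nat \<Rightarrow> nat \<Rightarrow> (nat \<Rightarrow> nat \<Rightarrow> nat) \<Rightarrow> bool" where
  "rect_tableau g n r T \<longleftrightarrow>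
     (\<forall>a<n. \<forall>t\<le>r. T a t \<in> {1..g}) \<and>
     inj_on (\<lambda>(a, t). T a t) ({..<n} \<times> {..r}) \<and>
     (\<forall>a<n. \<forall>t t'. t < t' \<and> t' \<le> r \<longrightarrow> T a t < T a t') \<and>
     (\<forall>t\<le>r. \<forall>a a'. a < a' \<and> a' < n \<longrightarrow> T a t < T a' t)"

definition column :: "nat \<Rightarrow> (nat \<Rightarrow> nat \<Rightarrow> nat) \<Rightarrow> nat \<Rightarrow> nat set" where
  "column n T t = {T a t | a. a < n}"

definition entries :: "nat \<Rightarrow> nat \<Rightarrow> (nat \<Rightarrow> nat \<Rightarrow> nat) \<Rightarrow> nat set" where
  "entries n r T = (\<Union>t\<le>r. column n T t)"

definition col_of :: "nat \<Rightarrow> nat \<Rightarrow> (nat \<Rightarrow> nat \<Rightarrow> nat) \<Rightarrow> nat \<Rightarrow> nat" where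
  "col_of n r T i = (THE t. t \<le> r \<and> i \<in> column n T t)"

definition beta :: "nat \<Rightarrow> (nat \<Rightarrow> nat \<Rightarrow> nat) \<Rightarrow> nat \<Rightarrow> nat \<Rightarrow> nat" where
  "beta n T i t = card {j \<in> column n T t. j \<le> i}"

text \<open>Genericity of a point \<open>y\<close> of \<open>\<Gamma>\<^sub>i\<close> is relative to the integers \<open>v s = u\<^sub>s(i - 1)\<close>.\<close>

definition generic_point ::
  "(nat, nat \<times> bool) metric_graph \<Rightarrow> nat \<Rightarrow> nat \<Rightarrow> (nat \<Rightarrow> int) \<Rightarrow> (nat, nat \<times> bool) mpoint \<Rightarrow> bool" where
  "generic_point G r i v y \<longleftrightarrow>
     (\<forall>s\<le>r. \<not> lin_equiv G (v s \<odot> Q (i - 1) + 1 \<odot> y) ((v s + 1) \<odot> Q i))"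

definition chain_divisor ::
  "nat \<Rightarrow> int \<Rightarrow> (nat \<Rightarrow> int) \<Rightarrow> (nat \<Rightarrow> (nat, nat \<times> bool) mpoint) \<Rightarrow> (nat, nat \<times> bool) divisor" where
  "chain_divisor g u \<epsilon> x = u \<odot> Q 0 + (\<Sum>i=1..g. \<epsilon> i \<odot> x i)"

text \<open>\<open>U s i\<close> stands for \<open>u\<^sub>s(i)\<close>.\<close>

definition component_data ::
  "nat \<Rightarrow> (nat, nat \<times> bool) metric_graph \<Rightarrow> nat \<Rightarrow> nat \<Rightarrow> (nat \<Rightarrow> nat \<Rightarrow> nat) \<Rightarrow>
   int \<Rightarrow> (nat \<Rightarrow> int) \<Rightarrow> (nat \<Rightarrow> (nat, nat \<times> bool) mpoint) \<Rightarrow> (nat \<Rightarrow> nat \<Rightarrow> int) \<Rightarrow> bool" where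
  "component_data g G n r T u \<epsilon> x U \<longleftrightarrow>
     (\<forall>i\<in>{1..g}. \<epsilon> i \<in> {0, 1} \<and> x i \<in> chain_loop G i - {Q (i - 1)}) \<and>
     (\<forall>s\<le>r. U s 0 = u - int s) \<and> U r 0 = 0 \<and> (\<forall>s\<le>r. U s g = int r - int s) \<and>
     (\<forall>i\<le>g. (\<forall>s<r. U s i > U (Suc s) i) \<and> U r i \<ge> 0) \<and>
     (\<forall>i\<in>{1..g}.
        (i \<in> column n T r \<longrightarrow>
           \<epsilon> i = 0 \<and> U r (i - 1) = 0 \<and>
           (\<forall>s<r. U s i = U s (i - 1) - 1) \<and> U r i = U r (i - 1)) \<and>
        (\<forall>t<r. i \<in> column n T t \<longrightarrow>
           \<epsilon> i = 1 \<and>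
           lin_equiv G (U t (i - 1) \<odot> Q (i - 1) + 1 \<odot> x i) ((U t (i - 1) + 1) \<odot> Q i) \<and>
           (t > 0 \<longrightarrow> U t (i - 1) + 1 < U (t - 1) (i - 1)) \<and>
           U t i = U t (i - 1) + 1 \<and> (\<forall>s\<le>r. s \<noteq> t \<longrightarrow> U s i = U s (i - 1))) \<and>
        (i \<notin> entries n r T \<longrightarrow>
           \<epsilon> i = 1 \<and> generic_point G r i (\<lambda>s. U s (i - 1)) (x i) \<and>
           (\<forall>s\<le>r. U s i = U s (i - 1))))"

definition component_general_points ::
  "nat \<Rightarrow> (nat, nat \<times> bool) metric_graph \<Rightarrow> int \<Rightarrow> nat \<Rightarrow> nat \<Rightarrow> (nat \<Rightarrow> nat \<Rightarrow> nat) \<Rightarrow>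
   (nat, nat \<times> bool) divisor set set" where
  "component_general_points g G d n r T =
     {div_class G (chain_divisor g u \<epsilon> x) | u \<epsilon> x.
        deg (chain_divisor g u \<epsilon> x) = d \<and> (\<exists>U. component_data g G n r T u \<epsilon> x U)}"

end

theory Submission
  imports Defs
begin

text \<open>The recursion for \<open>u\<^sub>s(i)\<close> raises \<open>u\<^sub>s\<close> by one at each entry of column \<open>s < r\<close> and lowers all
  \<open>u\<^sub>s\<close> with \<open>s < r\<close> by one at each entry of column \<open>r\<close>; as \<open>u\<^sub>r(0) = 0\<close> forces \<open>u = r\<close>, it solves to
  \<open>u\<^sub>s(i) = r - s + \<beta>\<^sub>i\<^sub>,\<^sub>s - \<beta>\<^sub>i\<^sub>,\<^sub>r\<close>. Substituting this into the conditions on the \<open>x\<^sub>i\<close> gives the claim.\<close>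

text \<open>All entries of a tableau are at least 1, so none is counted at \<open>0\<close>. This
  makes the closed form for \<open>U\<close> agree with the initial values
  \<open>u - s\<close>.\<close>

lemma beta_0:
  assumes "rect_tableau g n r T" and "t \<le> r"
  shows "beta n T 0 t = 0"
proof -
  have "{j \<in> column n T t. j \<le> 0} = {}"
    using assms by (fastforce simp: rect_tableau_def column_def)
  then show ?thesis by (simp add: beta_def)
qed

text \<open>Only the number \<open>Suc i\<close> itself can join the count. The increment has the
  shape of one step of the recursion for \<open>U\<close>.\<close>

lemma beta_Suc:
  "beta n T (Suc i) t = beta n T i t + (if Suc i \<in> column n T t then 1 else 0)"
proof -
  have "{j \<in> column n T t. j \<le> Suc i} =
      (if Suc i \<in> column n T t then insert (Suc i) {j \<in> column n T t. j \<le> i}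
       else {j \<in> column n T t. j \<le> i})"
    by (auto simp: le_Suc_eq)
  then show ?thesis by (simp add: beta_def)
qed

text \<open>Injectivity of \<open>T\<close> on cells: a number occupies at most one cell.\<close>

lemma column_unique:
  assumes "rect_tableau g n r T" and "s \<le> r" and "t \<le> r"
    and "i \<in> column n T s" and "i \<in> column n T t"
  shows "s = t"
  using assms by (auto simp: rect_tableau_def column_def inj_on_def)

text \<open>Uniqueness of the column makes the definite description in \<open>col_of\<close>
  meaningful.\<close>

lemma col_of_eq:
  assumes "rect_tableau g n r T" and "t \<le> r" and "i \<in> column n T t"
  shows "col_of n r T i = t"
  unfolding col_of_def
  using assms by (intro the_equality) (auto intro: column_unique)

lemma component_data_u_eq:
  assumes "component_data g G n r T u \<epsilon> x U"
  shows "u = int r"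
proof -
  have "\<forall>s\<le>r. U s 0 = u - int s" "U r 0 = 0"
    using assms unfolding component_data_def by blast+
  then show ?thesis by simp
qed

lemma component_data_U_eq:
  assumes T: "rect_tableau g n r T" and U: "component_data g G n r T u \<epsilon> x U"
    and "i \<le> g" and "s \<le> r"
  shows "U s i = int r + int (beta n T i s) - int s - int (beta n T i r)"
  using \<open>i \<le> g\<close> \<open>s \<le> r\<close>
proof (induction i arbitrary: s)
  case 0
  have "U s 0 = u - int s"
    using U 0 by (simp add: component_data_def)
  then show ?case using T 0 component_data_u_eq[OF U] by (simp add: beta_0)
next
  case (Suc i)
  have mem: "Suc i \<in> {1..g}" using Suc.prems by simp
  have IH: "U s i = int r + int (beta n T i s) - int s - int (beta n T i r)"
    using Suc by simp
  \<comment> \<open>One case for each rule of the recursion.\<close>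
  consider (last) "Suc i \<in> column n T r"
    | (inner) t where "t < r" "Suc i \<in> column n T t"
    | (none) "Suc i \<notin> entries n r T"
    unfolding entries_def by (metis UN_E atMost_iff le_less)
  then show ?case
  proof cases
    case last
    then have "\<forall>s<r. U s (Suc i) = U s i - 1" "U r (Suc i) = U r i"
      using U mem by (auto simp: component_data_def)
    \<comment> \<open>For \<open>s < r\<close> only the count of column \<open>r\<close> grows,
      which lowers the formula by 1. For \<open>s = r\<close> the two counts cancel and the value
      stays 0.\<close>
    moreover have "Suc i \<notin> column n T s" if "s < r"
      using column_unique[OF T _ order_refl _ last, of s] that by auto
    ultimately show ?thesis
      using IH last Suc.prems by (cases "s = r") (simp_all add: beta_Suc)
  next
    case inner
    then have "U t (Suc i) = U t i + 1" "\<forall>s\<le>r. s \<noteq> t \<longrightarrow> U s (Suc i) = U s i"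
      using U mem unfolding component_data_def by fastforce+
    \<comment> \<open>Needed both for \<open>s' = s\<close> and for \<open>s' = r\<close>: since
      \<open>t < r\<close>, the subtracted count does not change.\<close>
    moreover have "Suc i \<in> column n T s' \<longleftrightarrow> s' = t" if "s' \<le> r" for s'
      using column_unique[OF T that _ _ inner(2)] inner by auto
    ultimately show ?thesis
      using IH inner Suc.prems by (cases "s = t") (simp_all add: beta_Suc)
  next
    case none
    then have "U s (Suc i) = U s i"
      using U mem Suc.prems by (simp add: component_data_def)
    moreover have "Suc i \<notin> column n T s" "Suc i \<notin> column n T r"
      using none Suc.prems by (auto simp: entries_def)
    ultimately show ?thesis using IH by (simp add: beta_Suc)
  qed
qed

theorem lemma3p5:
  fixes g r n :: nat and d :: int and l m :: "nat \<Rightarrow> real"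
    and T :: "nat \<Rightarrow> nat \<Rightarrow> nat"
    and \<Gamma> :: "(nat, nat \<times> bool) metric_graph"
    and C :: "(nat, nat \<times> bool) divisor set"
  assumes "general_chain g l m" and "\<Gamma> = chain g l m"
    and "int n = int g - d + int r"
    and "rect_tableau g n r T"
    and "C \<in> component_general_points g \<Gamma> d n r T"
  shows "\<exists>\<epsilon> x.
    C = div_class \<Gamma> (int r \<odot> Q 0 + (\<Sum>i=1..g. \<epsilon> i \<odot> x i)) \<and>
    (\<forall>i\<in>{1..g}. x i \<in> chain_loop \<Gamma> i) \<and>
    (\<forall>i\<in>{1..g}.
      (i \<in> entries n r T \<and> col_of n r T i = r \<longrightarrow> \<epsilon> i = 0) \<and>
      (i \<in> entries n r T \<and> col_of n r T i < r \<longrightarrow>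
         \<epsilon> i = 1 \<and>
         (let t = col_of n r T i;
              k = int r + int (beta n T i t) - int t - int (beta n T i r)
          in lin_equiv \<Gamma> (1 \<odot> x i + (k - 1) \<odot> Q (i - 1)) (k \<odot> Q i))) \<and>
      (i \<notin> entries n r T \<longrightarrow>
         \<epsilon> i = 1 \<and>
         generic_point \<Gamma> r i
           (\<lambda>s. int r + int (beta n T (i - 1) s) - int s - int (beta n T (i - 1) r)) (x i)))"
proof -
  note T = \<open>rect_tableau g n r T\<close>
  obtain u \<epsilon> x U where C: "C = div_class \<Gamma> (chain_divisor g u \<epsilon> x)"
    and U: "component_data g \<Gamma> n r T u \<epsilon> x U"
    using assms by (auto simp: component_general_points_def)
  have u: "u = int r" using U by (rule component_data_u_eq)
  note U_eq = component_data_U_eq[OF T U]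
  have last: "\<epsilon> i = 0" if "i \<in> {1..g}" "i \<in> column n T r" for i
    using U that by (simp add: component_data_def)
  have inner: "\<epsilon> i = 1 \<and> lin_equiv \<Gamma> (1 \<odot> x i + (k - 1) \<odot> Q (i - 1)) (k \<odot> Q i)"
    if "i \<in> {1..g}" "t < r" "i \<in> column n T t"
      and k: "k = int r + int (beta n T i t) - int t - int (beta n T i r)" for i t k
  proof -
    have "\<epsilon> i = 1" "U t i = U t (i - 1) + 1"
      and "lin_equiv \<Gamma> (U t (i - 1) \<odot> Q (i - 1) + 1 \<odot> x i) ((U t (i - 1) + 1) \<odot> Q i)"
      using U that(1-3) by (simp_all add: component_data_def)
    \<comment> \<open>The count up to \<open>i\<close> includes \<open>i\<close> itself, so
      \<open>k\<close> is the value after step \<open>i\<close>, while the equivalence in the data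
      uses the value \<open>k - 1\<close> before it.\<close>
    moreover have "U t i = k" using U_eq[of i t] that by simp
    moreover from calculation have "U t (i - 1) = k - 1" by simp
    ultimately show ?thesis by (simp add: add.commute)
  qed
  have none: "\<epsilon> i = 1 \<and> generic_point \<Gamma> r i
      (\<lambda>s. int r + int (beta n T (i - 1) s) - int s - int (beta n T (i - 1) r)) (x i)"
    if "i \<in> {1..g}" "i \<notin> entries n r T" for i
  proof -
    have "\<epsilon> i = 1" "generic_point \<Gamma> r i (\<lambda>s. U s (i - 1)) (x i)"
      using U that by (simp_all add: component_data_def)
    \<comment> \<open>Genericity only tests indices \<open>s \<le> r\<close>, exactly where the
      closed form holds.\<close>
    moreover have "U s (i - 1) = int r + int (beta n T (i - 1) s) - int s - int (beta n T (i - 1) r)"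
      if "s \<le> r" for s
      using \<open>i \<in> {1..g}\<close> that by (intro U_eq) auto
    ultimately show ?thesis by (simp add: generic_point_def)
  qed
  \<comment> \<open>Translates conditions on \<open>col_of\<close> into the column membership
    required by \<open>last\<close> and \<open>inner\<close>.\<close>
  have col: "i \<in> column n T (col_of n r T i)" if "i \<in> entries n r T" for i
    using that col_of_eq[OF T] by (auto simp: entries_def)
  have loop: "x i \<in> chain_loop \<Gamma> i" if "i \<in> {1..g}" for i
    using U that by (simp add: component_data_def)
  show ?thesis
  \<comment> \<open>The data defining the class serve as witnesses unchanged; only \<open>u\<close>
    and \<open>U\<close> are eliminated.\<close>
  proof (intro exI[of _ \<epsilon>] exI[of _ x] conjI ballI)
    show "C = div_class \<Gamma> (int r \<odot> Q 0 + (\<Sum>i=1..g. \<epsilon> i \<odot> x i))"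
      using C u by (simp add: chain_divisor_def)
  next
    fix i assume i: "i \<in> {1..g}"
    show "x i \<in> chain_loop \<Gamma> i" using i by (rule loop)
    show "i \<in> entries n r T \<and> col_of n r T i = r \<longrightarrow> \<epsilon> i = 0"
      using last[OF i] col[of i] by auto
    show "i \<in> entries n r T \<and> col_of n r T i < r \<longrightarrow> \<epsilon> i = 1 \<and>
        (let t = col_of n r T i;
             k = int r + int (beta n T i t) - int t - int (beta n T i r)
         in lin_equiv \<Gamma> (1 \<odot> x i + (k - 1) \<odot> Q (i - 1)) (k \<odot> Q i))"
      unfolding Let_def using inner[OF i _ col refl] by blast
    show "i \<notin> entries n r T \<longrightarrow> \<epsilon> i = 1 \<and> generic_point \<Gamma> r i
        (\<lambda>s. int r + int (beta n T (i - 1) s) - int s - int (beta n T (i - 1) r)) (x i)"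
      using none[OF i] by blast
  qed
qed

end
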